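(* Let $f\colon\mathcal X\setminus\mathcal O\to(0,\infty)$ and $g\colon\mathcal O\to\mathbb R$. A solution $u\colon\mathcal X\to\mathbb R$ of $$\begin{cases}\displaystyle\inf_{\alpha\in\mathcal A_{n/2}}\sum_{i=1}^{n/2}\alpha_i\bigl(H_i[u](x)-u(x)\bigr)=\frac n2f(x)^{2/n},&x\in\mathcal X\setminus\mathcal O,\\ u(x)=g(x),&x\in\mathcal O,\end{cases}$$ whenever it exists, is unique.
   Context: $\mathcal G=(\mathcal X,E)$ is a finite simple undirected graph, $\mathcal O\subseteq\mathcal X$ is the set of boundary vertices, and $\mathcal N_x$ is the set of neighbors of $x$. There is a fixed even integer $n\ge2$ with $|\mathcal N_x|=n$ for every $x\in\mathcal X\setminus\mathcal O$ (no degree condition on vertices of $\mathcal O$). For $u\colon\mathcal X\to\mathbb R$, $x\in\mathcal X\setminus\mathcal O$ and $i\in\{1,\dots,n/2\}$, define $$H_i[u](x)=\min_{\substack{S\subseteq\mathcal N_x\\ |S|=2i}}\ \max_{\substack{y,z\in S\\ y\ne z}}\frac{u(y)+u(z)}2,$$ and $\mathcal A_k=\{\alpha\in(0,\infty)^k:\prod_{i=1}^k\alpha_i=1\}$. *)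

theory Defs
  imports "HOL-Analysis.Analysis" "HOL-Library.Extended_Real"
begin

(* Undirected edges are two-element sets of vertices, which excludes loops and multiple edges. *)
definition finite_simple_graph :: "'a set \<Rightarrow> 'a set set \<Rightarrow> bool" where
  "finite_simple_graph X E \<longleftrightarrow> finite X \<and> (\<forall>e\<in>E. e \<subseteq> X \<and> card e = 2)"

definition neighbors :: "'a set set \<Rightarrow> 'a \<Rightarrow> 'a set" where
  "neighbors E x = {y. {x, y} \<in> E}"

(* Min and Max are meaningful when neighbors E x is finite and 1 \<le> i, 2 * i \<le> card (neighbors E x):
   then the sets involved are finite and nonempty. *)
definition H :: "'a set set \<Rightarrow> nat \<Rightarrow> ('a \<Rightarrow> real) \<Rightarrow> 'a \<Rightarrow> real" where
  "H E i u x =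
     Min ((\<lambda>S. Max {(u y + u z) / 2 | y z. y \<in> S \<and> z \<in> S \<and> y \<noteq> z})
            ` {S. S \<subseteq> neighbors E x \<and> card S = 2 * i})"

(* A k-tuple is an extensional function on {1..k}. *)
definition \<A> :: "nat \<Rightarrow> (nat \<Rightarrow> real) set" where
  "\<A> k = {\<alpha> \<in> {1..k} \<rightarrow>\<^sub>E {0<..}. (\<Prod>i=1..k. \<alpha> i) = 1}"

(* The infimum is taken in the extended reals, since it is -\<infinity> at a vertex where
   n \<ge> 4 and H E i u x < u x for some i; Inf on real is unspecified for sets unbounded below. *)
definition is_solution ::
  "'a set \<Rightarrow> 'a set set \<Rightarrow> 'a set \<Rightarrow> nat \<Rightarrow> ('a \<Rightarrow> real) \<Rightarrow> ('a \<Rightarrow> real) \<Rightarrow> ('a \<Rightarrow> real) \<Rightarrow> bool"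
where
  "is_solution X E B n f g u \<longleftrightarrow>
     (\<forall>x\<in>X - B. (INF \<alpha>\<in>\<A> (n div 2). ereal (\<Sum>i=1..n div 2. \<alpha> i * (H E i u x - u x)))
                  = ereal (real n / 2 * f x powr (2 / real n))) \<and>
     (\<forall>x\<in>B. u x = g x)"

end

theory Submission
  imports Defs
begin

text \<open>
  Take a vertex maximising \<open>u\<close> among those where \<open>u - v\<close> attains a positive maximum \<open>M\<close>; it is not on
  the boundary. There \<open>H\<^sub>i[u] - u \<le> H\<^sub>i[v] - v\<close> for every \<open>i\<close>. Positivity of the infimum forces all
  these numbers to be positive, and then by AM-GM the infimum is a strictly increasing function of
  each of them, so they agree for \<open>i = n/2\<close>. A pair of neighbours attaining the maximum in
  \<open>H\<^sub>n\<^sub>/\<^sub>2[u]\<close> then also has \<open>u - v = M\<close>, and its mean under \<open>u\<close> exceeds \<open>u x\<close>, contradicting the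
  choice of \<open>x\<close>.
\<close>

section \<open>Pair means over neighbour sets and the operators \<open>H\<close>\<close>

definition pair_means :: "('a \<Rightarrow> real) \<Rightarrow> 'a set \<Rightarrow> real set" where
  "pair_means u S = {(u y + u z) / 2 | y z. y \<in> S \<and> z \<in> S \<and> y \<noteq> z}"

lemma finite_pair_means: "finite S \<Longrightarrow> finite (pair_means u S)"
proof -
  assume "finite S"
  have "pair_means u S \<subseteq> (\<lambda>(y, z). (u y + u z) / 2) ` (S \<times> S)"
    by (force simp: pair_means_def)
  with \<open>finite S\<close> show ?thesis
    by (meson finite_SigmaI finite_imageI finite_subset)
qed

lemma Max_pair_means_ge:
  assumes "finite S" "y \<in> S" "z \<in> S" "y \<noteq> z"
  shows "(u y + u z) / 2 \<le> Max (pair_means u S)"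
  using assms by (intro Max_ge finite_pair_means) (auto simp: pair_means_def)

lemma Max_pair_means_attained:
  assumes "finite S" "card S \<ge> 2"
  obtains y z where "y \<in> S" "z \<in> S" "y \<noteq> z" "Max (pair_means u S) = (u y + u z) / 2"
proof -
  obtain y z where "y \<in> S" "z \<in> S" "y \<noteq> z"
    using assms by (metis One_nat_def Suc_1 card_le_Suc0_iff_eq not_less_eq_eq)
  then have "(u y + u z) / 2 \<in> pair_means u S"
    unfolding pair_means_def by blast
  then have "pair_means u S \<noteq> {}"
    by blast
  then have "Max (pair_means u S) \<in> pair_means u S"
    using Max_in[OF finite_pair_means[OF assms(1)]] by blast
  then show thesis
    using that by (auto simp: pair_means_def)
qed

lemma H_pair_means:
  "H E i u x = Min ((\<lambda>S. Max (pair_means u S)) ` {S. S \<subseteq> neighbors E x \<and> card S = 2 * i})"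
  by (simp add: H_def pair_means_def)

text \<open>A set \<open>S\<close> optimal for \<open>v\<close> competes in the minimum defining
  \<open>H E i u x\<close>, and the pair maximising the mean of \<open>u\<close> over
  \<open>S\<close> has a \<open>v\<close>-mean smaller by at most \<open>M\<close>.\<close>

lemma H_le_shift:
  assumes fin: "finite (neighbors E x)" and i: "1 \<le> i" "2 * i \<le> card (neighbors E x)"
    and le: "\<And>y. y \<in> neighbors E x \<Longrightarrow> u y \<le> v y + M"
  shows "H E i u x \<le> H E i v x + M"
proof -
  let ?T = "{S. S \<subseteq> neighbors E x \<and> card S = 2 * i}"
  have finT: "finite ?T"
    using fin by simp
  have "?T \<noteq> {}"
    using obtain_subset_with_card_n[OF i(2)] by blast
  then have "H E i v x \<in> (\<lambda>S. Max (pair_means v S)) ` ?T"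
    unfolding H_pair_means using finT by (intro Min_in) auto
  then obtain S where S: "S \<in> ?T" "H E i v x = Max (pair_means v S)"
    by blast
  have finS: "finite S"
    using S(1) fin finite_subset by auto
  have "card S \<ge> 2"
    using S(1) i(1) by auto
  then obtain y z where yz: "y \<in> S" "z \<in> S" "y \<noteq> z" "Max (pair_means u S) = (u y + u z) / 2"
    using Max_pair_means_attained[OF finS] by metis
  have "H E i u x \<le> Max (pair_means u S)"
    unfolding H_pair_means using S(1) finT by (intro Min_le) auto
  moreover have "u y \<le> v y + M" "u z \<le> v z + M"
    using S(1) yz(1,2) by (auto intro!: le)
  ultimately show ?thesis
    using Max_pair_means_ge[OF finS yz(1-3), of v] S(2) yz(4) by (simp add: field_simps)
qed

text \<open>The whole neighbourhood is the only admissible set, so the minimum disappears. Hence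
  every pair of neighbours bounds \<open>H E m\<close> from below, for \<open>u\<close> and
  \<open>v\<close> alike.\<close>

lemma H_top:
  assumes "finite (neighbors E x)" "card (neighbors E x) = 2 * m"
  shows "H E m u x = Max (pair_means u (neighbors E x))"
proof -
  have "{S. S \<subseteq> neighbors E x \<and> card S = 2 * m} = {neighbors E x}"
    using assms card_subset_eq[OF assms(1)] by auto
  then show ?thesis
    by (simp add: H_pair_means)
qed

section \<open>Infimum of weighted sums over weights of product one\<close>

lemma INF_weighted_sum_pos_imp_pos:
  fixes h :: "nat \<Rightarrow> real"
  assumes c: "c > 0" and ge: "\<And>\<alpha>. \<alpha> \<in> \<A> k \<Longrightarrow> c \<le> (\<Sum>i=1..k. \<alpha> i * h i)"
    and j: "j \<in> {1..k}"
  shows "h j > 0"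
proof (rule ccontr)
  assume "\<not> h j > 0"
  define C where "C = (\<Sum>i\<in>{1..k}-{j}. \<bar>h i\<bar>)"
  \<comment> \<open>With weight \<open>t\<close> off \<open>j\<close>, the other terms add up to at
    most \<open>t * C < c\<close>. The summand 1 in the denominator covers
    \<open>C = 0\<close>.\<close>
  define t where "t = c / (C + 1) / 2"
  have C: "C \<ge> 0"
    by (simp add: C_def sum_nonneg)
  have t: "t > 0"
    using c C by (simp add: t_def)
  \<comment> \<open>Small weights away from \<open>j\<close>, compensated by a large one at \<open>j\<close>.\<close>
  define \<alpha> where
    "\<alpha> = (\<lambda>i\<in>{1..k}. if i = j then 1 / t ^ card ({1..k} - {j}) else t)"
  have "(\<Prod>i=1..k. \<alpha> i) = \<alpha> j * (\<Prod>i\<in>{1..k}-{j}. \<alpha> i)"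
    using j by (simp add: prod.remove)
  also have "(\<Prod>i\<in>{1..k}-{j}. \<alpha> i) = (\<Prod>i\<in>{1..k}-{j}. t)"
    by (intro prod.cong) (auto simp: \<alpha>_def)
  also have "\<alpha> j * \<dots> = 1"
    using j t by (simp add: \<alpha>_def)
  finally have "\<alpha> \<in> \<A> k"
    using t by (auto simp: \<A>_def \<alpha>_def)
  then have "c \<le> (\<Sum>i=1..k. \<alpha> i * h i)"
    by (rule ge)
  also have "\<dots> = \<alpha> j * h j + (\<Sum>i\<in>{1..k}-{j}. \<alpha> i * h i)"
    using j by (simp add: sum.remove)
  also have "\<dots> \<le> 0 + (\<Sum>i\<in>{1..k}-{j}. t * \<bar>h i\<bar>)"
  proof (intro add_mono sum_mono)
    have "\<alpha> j \<ge> 0"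
      using j t by (simp add: \<alpha>_def)
    then show "\<alpha> j * h j \<le> 0"
      using \<open>\<not> h j > 0\<close> by (simp add: mult_nonneg_nonpos)
  next
    fix i assume "i \<in> {1..k} - {j}"
    then show "\<alpha> i * h i \<le> t * \<bar>h i\<bar>"
      using t by (auto simp: \<alpha>_def intro!: mult_left_mono)
  qed
  also have "\<dots> = t * C"
    by (simp add: C_def sum_distrib_left)
  also have "\<dots> < c"
  proof -
    have "c * C < c * (2 * (C + 1))"
      using c C by (intro mult_strict_left_mono) auto
    then show ?thesis
      using C by (simp add: t_def field_simps)
  qed
  finally show False
    by simp
qed

text \<open>The equality case of AM-GM: the weights make every term \<open>\<alpha> i * h i\<close>
  equal to the geometric mean of the \<open>h i\<close>.\<close>

lemma INF_weighted_sum_attained: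
  fixes h :: "nat \<Rightarrow> real"
  assumes k: "k \<ge> 1" and pos: "\<And>i. i \<in> {1..k} \<Longrightarrow> h i > 0"
  obtains \<alpha> where "\<alpha> \<in> \<A> k" "(\<Sum>i=1..k. \<alpha> i * h i) = real k * root k (\<Prod>i=1..k. h i)"
proof
  define G where "G = root k (\<Prod>i=1..k. h i)"
  define \<alpha> where "\<alpha> = (\<lambda>i\<in>{1..k}. G / h i)"
  have P: "(\<Prod>i=1..k. h i) > 0"
    by (intro prod_pos) (use pos in auto)
  have G: "G > 0" "G ^ k = (\<Prod>i=1..k. h i)"
    using P k by (auto simp: G_def)
  have "(\<Prod>i=1..k. \<alpha> i) = (\<Prod>i=1..k. G / h i)"
    by (intro prod.cong) (auto simp: \<alpha>_def)
  also have "\<dots> = 1"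
    using G k by (simp only: prod_dividef flip: G(2)) simp
  finally show "\<alpha> \<in> \<A> k"
    using G(1) pos by (auto simp: \<A>_def \<alpha>_def)
  have "(\<Sum>i=1..k. \<alpha> i * h i) = (\<Sum>i=1..k. G)"
    by (intro sum.cong) (use pos in \<open>force simp: \<alpha>_def\<close>)+
  then show "(\<Sum>i=1..k. \<alpha> i * h i) = real k * root k (\<Prod>i=1..k. h i)"
    by (simp add: G_def)
qed

text \<open>AM-GM for the terms \<open>\<alpha> i * h i\<close>, whose product is that of the
  \<open>h i\<close> because the weights multiply to 1.\<close>

lemma weighted_sum_ge_root_prod:
  fixes h :: "nat \<Rightarrow> real"
  assumes k: "k \<ge> 1" and pos: "\<And>i. i \<in> {1..k} \<Longrightarrow> h i > 0" and \<alpha>: "\<alpha> \<in> \<A> k"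
  shows "real k * root k (\<Prod>i=1..k. h i) \<le> (\<Sum>i=1..k. \<alpha> i * h i)"
proof -
  have \<alpha>_pos: "\<alpha> i > 0" if "i \<in> {1..k}" for i
    using \<alpha> that by (auto simp: \<A>_def)
  have "root k (\<Prod>i=1..k. h i) = root k (\<Prod>i=1..k. \<alpha> i * h i)"
    using \<alpha> by (simp add: \<A>_def prod.distrib)
  also have "\<dots> \<le> (\<Sum>i=1..k. \<alpha> i * h i) / real k"
  proof -
    have "(\<Prod>i=1..k. \<alpha> i * h i) > 0"
      by (intro prod_pos) (use \<alpha>_pos pos in auto)
    moreover have "(\<Prod>i=1..k. \<alpha> i * h i) powr (1 / real k) \<le> (\<Sum>i=1..k. \<alpha> i * h i / real k)"
      using arith_geom_mean[of "{1..k}" "\<lambda>i. \<alpha> i * h i"] k \<alpha>_pos pos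
      by (simp add: less_imp_le)
    ultimately show ?thesis
      using k by (simp add: root_powr_inverse sum_divide_distrib)
  qed
  finally show ?thesis
    using k by (simp add: field_simps)
qed

lemma INF_weighted_sum_eq_imp_eq:
  fixes h h' :: "nat \<Rightarrow> real"
  assumes k: "k \<ge> 1" and c: "c > 0"
    and h: "(INF \<alpha>\<in>\<A> k. ereal (\<Sum>i=1..k. \<alpha> i * h i)) = ereal c"
    and h': "(INF \<alpha>\<in>\<A> k. ereal (\<Sum>i=1..k. \<alpha> i * h' i)) = ereal c"
    and le: "\<And>i. i \<in> {1..k} \<Longrightarrow> h i \<le> h' i" and j: "j \<in> {1..k}"
  shows "h j > 0" "h j = h' j"
proof -
  have ge: "c \<le> (\<Sum>i=1..k. \<alpha> i * h i)" if "\<alpha> \<in> \<A> k" for \<alpha>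
    using INF_lower[OF that, of "\<lambda>\<alpha>. ereal (\<Sum>i=1..k. \<alpha> i * h i)"] h by simp
  have pos: "h i > 0" if "i \<in> {1..k}" for i
    by (rule INF_weighted_sum_pos_imp_pos[OF c ge that])
  then show "h j > 0"
    using j by blast
  have pos': "h' i > 0" if "i \<in> {1..k}" for i
    using pos[OF that] le[OF that] by linarith
  \<comment> \<open>Optimal weights for \<open>h\<close> bound \<open>c\<close> from above, while
    AM-GM for \<open>h'\<close> bounds it from below. So the products compare in the direction
    opposite to \<open>h i \<le> h' i\<close>.\<close>
  have "c \<le> real k * root k (\<Prod>i=1..k. h i)"
    using INF_weighted_sum_attained[of k h] k pos ge by metis
  moreover have "ereal (real k * root k (\<Prod>i=1..k. h' i)) \<le> ereal c"
    unfolding h'[symmetric]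
    by (intro INF_greatest) (use weighted_sum_ge_root_prod[OF k] pos' in auto)
  ultimately have "real k * root k (\<Prod>i=1..k. h' i) \<le> real k * root k (\<Prod>i=1..k. h i)"
    by (simp only: ereal_less_eq)
  then have "root k (\<Prod>i=1..k. h' i) \<le> root k (\<Prod>i=1..k. h i)"
    using k by simp
  then have prod_le: "(\<Prod>i=1..k. h' i) \<le> (\<Prod>i=1..k. h i)"
    using k by simp
  show "h j = h' j"
  proof (rule ccontr)
    assume "h j \<noteq> h' j"
    then have "h j < h' j"
      using le[OF j] by simp
    \<comment> \<open>A strict gap at \<open>j\<close> survives multiplication, since the remaining
      product of the \<open>h i\<close> is positive and no larger than that of the
      \<open>h' i\<close>.\<close>
    moreover have "(\<Prod>i\<in>{1..k}-{j}. h i) \<le> (\<Prod>i\<in>{1..k}-{j}. h' i)"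
      by (intro prod_mono) (use le pos in \<open>force simp: less_imp_le\<close>)
    moreover have "(\<Prod>i\<in>{1..k}-{j}. h i) > 0"
      by (intro prod_pos) (use pos in auto)
    ultimately have "h j * (\<Prod>i\<in>{1..k}-{j}. h i) < h' j * (\<Prod>i\<in>{1..k}-{j}. h' i)"
      using pos[OF j] by (intro mult_less_le_imp_less) auto
    then show False
      using prod_le j by (simp add: prod.remove)
  qed
qed

section \<open>Comparison of two solutions\<close>

lemma is_solution_le:
  fixes X B :: "'a set" and E :: "'a set set" and n :: nat
    and f g u v :: "'a \<Rightarrow> real"
  assumes G: "finite_simple_graph X E"
    and n: "even n" "n \<ge> 2"
    and deg: "\<And>x. x \<in> X - B \<Longrightarrow> card (neighbors E x) = n"
    and f: "\<And>x. x \<in> X - B \<Longrightarrow> f x > 0"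
    and u: "is_solution X E B n f g u"
    and v: "is_solution X E B n f g v"
    and "a \<in> X"
  shows "u a \<le> v a"
proof (rule ccontr)
  assume "\<not> u a \<le> v a"
  define M where "M = Max ((\<lambda>x. u x - v x) ` X)"
  define A where "A = {x \<in> X. u x - v x = M}"
  have finX: "finite X"
    using G by (simp add: finite_simple_graph_def)
  have le_M: "u y \<le> v y + M" if "y \<in> X" for y
  proof -
    have "u y - v y \<le> M"
      unfolding M_def using finX that by (intro Max_ge) auto
    then show ?thesis
      by simp
  qed
  have "M > 0"
    using le_M[OF \<open>a \<in> X\<close>] \<open>\<not> u a \<le> v a\<close> by linarith
  have "M \<in> (\<lambda>x. u x - v x) ` X"
    unfolding M_def using finX \<open>a \<in> X\<close> by (intro Max_in) auto
  then have "A \<noteq> {}"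
    by (auto simp: A_def)
  moreover have "finite A"
    using finX by (simp add: A_def)
  ultimately have "Max (u ` A) \<in> u ` A"
    by (intro Max_in) auto
  then obtain x where x: "x \<in> A" and x_max: "\<And>y. y \<in> A \<Longrightarrow> u y \<le> u x"
    using \<open>finite A\<close> by (metis (no_types, lifting) Max_ge finite_imageI imageE imageI)
  \<comment> \<open>On \<open>B\<close> both solutions equal \<open>g\<close>, so the difference
    there is 0, below \<open>M\<close>.\<close>
  have "x \<notin> B"
    using x u v \<open>M > 0\<close> by (auto simp: A_def is_solution_def)
  then have xX: "x \<in> X - B"
    using x by (simp add: A_def)
  have ux: "u x = v x + M"
    using x by (simp add: A_def)
  let ?N = "neighbors E x"
  \<comment> \<open>Neighbours may lie in \<open>B\<close>; the bound \<open>le_M\<close> covers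
    them because \<open>M\<close> is a maximum over all of \<open>X\<close>.\<close>
  have N: "?N \<subseteq> X"
    using G by (auto simp: neighbors_def finite_simple_graph_def)
  then have finN: "finite ?N"
    using finX finite_subset by blast
  define m where "m = n div 2"
  have m: "n = 2 * m" "m \<ge> 1"
    using n by (auto simp: m_def)
  have cardN: "card ?N = 2 * m"
    using deg[OF xX] m(1) by simp
  have le: "H E i u x - u x \<le> H E i v x - v x" if "i \<in> {1..m}" for i
  proof -
    have "H E i u x \<le> H E i v x + M"
      by (rule H_le_shift[OF finN]) (use that cardN N le_M in auto)
    then show ?thesis
      using ux by simp
  qed
  define c where "c = real n / 2 * f x powr (2 / real n)"
  have "c > 0"
    using n f[OF xX] by (simp add: c_def)
  have inf_u: "(INF \<alpha>\<in>\<A> m. ereal (\<Sum>i=1..m. \<alpha> i * (H E i u x - u x))) = ereal c"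
    and inf_v: "(INF \<alpha>\<in>\<A> m. ereal (\<Sum>i=1..m. \<alpha> i * (H E i v x - v x))) = ereal c"
    using u v xX unfolding is_solution_def m_def c_def by blast+
  have "m \<in> {1..m}"
    using m(2) by simp
  note cmp = INF_weighted_sum_eq_imp_eq[OF m(2) \<open>c > 0\<close> inf_u inf_v _ \<open>m \<in> {1..m}\<close>]
  have pos: "H E m u x - u x > 0"
    by (rule cmp(1)) (rule le)
  have eq: "H E m u x - u x = H E m v x - v x"
    by (rule cmp(2)) (rule le)
  have "card ?N \<ge> 2"
    using cardN m(2) by simp
  then obtain y z where yz: "y \<in> ?N" "z \<in> ?N" "y \<noteq> z"
      and Hu: "Max (pair_means u ?N) = (u y + u z) / 2"
    using Max_pair_means_attained[OF finN] by metis
  note top = H_top[OF finN cardN]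
  have "(v y + v z) / 2 \<le> H E m v x"
    unfolding top by (rule Max_pair_means_ge[OF finN yz])
  moreover have "H E m u x = (u y + u z) / 2"
    by (simp add: top Hu)
  moreover have "u y \<le> v y + M" "u z \<le> v z + M"
    using yz N le_M by auto
  \<comment> \<open>By \<open>eq\<close> and \<open>ux\<close>,
    \<open>H E m u x = H E m v x + M\<close>. Thus \<open>(u y + u z) / 2\<close> is at least
    \<open>(v y + v z) / 2 + M\<close>, so neither bound \<open>u \<le> v + M\<close> at
    \<open>y\<close> and \<open>z\<close> can be strict.\<close>
  ultimately have "u y - v y = M" "u z - v z = M" "(u y + u z) / 2 > u x"
    using pos eq ux by (simp_all add: field_simps)
  moreover from this have "y \<in> A" "z \<in> A"
    using yz N by (auto simp: A_def)
  \<comment> \<open>Membership in \<open>A\<close> gives \<open>u y \<le> u x\<close> and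
    \<open>u z \<le> u x\<close>, so the mean cannot exceed \<open>u x\<close>.\<close>
  ultimately show False
    using x_max[of y] x_max[of z] by argo
qed

theorem corollary3p6:
  fixes X B :: "'a set" and E :: "'a set set" and n :: nat
    and f g u v :: "'a \<Rightarrow> real"
  assumes "finite_simple_graph X E"
    and "B \<subseteq> X"
    and "even n" and "n \<ge> 2"
    and "\<And>x. x \<in> X - B \<Longrightarrow> card (neighbors E x) = n"
    and "\<And>x. x \<in> X - B \<Longrightarrow> f x > 0"
    and "is_solution X E B n f g u"
    and "is_solution X E B n f g v"
  shows "\<forall>x\<in>X. u x = v x"
  \<comment> \<open>The second instance exchanges the roles of \<open>u\<close> and
    \<open>v\<close>.\<close>
  using is_solution_le[OF assms(1,3-8)] is_solution_le[OF assms(1,3-6,8,7)]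
  by (blast intro: order_antisym)

end
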